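(* (a) Let $(X,\mathcal{T})$ be a topological space, $\mathcal{M}=CL(X)$, $\mathcal{P}$ a subbase for $\mathcal{T}$ and $\mathcal{O}=\mathcal{O}_{\mathcal{P}}^{\mathcal{M}}$. Then $2^{\mathrm{id}_X}=\mathrm{id}_{(\mathcal{M},\mathcal{O})}$, where $2^{\mathrm{id}_X}:(\mathcal{M},\mathcal{O})\to(\mathcal{M},\mathcal{O})$. (b) Let $(X,\mathcal{T})$, $(X',\mathcal{T}')$, $(X'',\mathcal{T}'')$ be topological spaces with subbases $\mathcal{P}$, $\mathcal{P}'$, $\mathcal{P}''$ for $\mathcal{T}$, $\mathcal{T}'$, $\mathcal{T}''$ respectively. Let $f:X\to X'$ and $g:X'\to X''$ be maps such that $f^{-1}(U')\in\mathcal{P}$ for every $U'\in\mathcal{P}'$ and $g^{-1}(U'')\in\mathcal{P}'$ for every $U''\in\mathcal{P}''$. Let $\mathcal{M}$ be a family of non-empty subsets of $X$, $\mathcal{M}'=CL(X')$, $\mathcal{M}''=CL(X'')$, $\mathcal{O}=\mathcal{O}_{\mathcal{P}}^{\mathcal{M}}$, $\mathcal{O}'=\mathcal{O}_{\mathcal{P}'}^{\mathcal{M}'}$ and $\mathcal{O}''=\mathcal{O}_{\mathcal{P}''}^{\mathcal{M}''}$. Then $2^{g\circ f}=2^g\circ 2^f$, where $2^f:(\mathcal{M},\mathcal{O})\to(\mathcal{M}',\mathcal{O}')$, $2^g:(\mathcal{M}',\mathcal{O}')\to(\mathcal{M}'',\mathcal{O}'')$ and $2^{g\circ f}:(\ma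thcal{M},\mathcal{O})\to(\mathcal{M}'',\mathcal{O}'')$.
   Context: For a topological space $Y$, $CL(Y)$ is the set of all non-empty closed subsets of $Y$. For a map $h:Y\to Z$ between topological spaces and a family $\mathcal{N}$ of non-empty subsets of $Y$, $2^h:\mathcal{N}\to CL(Z)$ is defined by $2^h(C)=\overline{h(C)}^{Z}$ (closure in $Z$). For $A\subseteq Y$ put $A_{\mathcal{N}}^-=\{N\in\mathcal{N}\mid N\cap A\neq\emptyset\}$. For a family $\mathcal{S}$ of subsets of $Y$ such that every $N\in\mathcal{N}$ meets $\bigcup\mathcal{S}$, $\mathcal{O}_{\mathcal{S}}^{\mathcal{N}}$ denotes the topology on $\mathcal{N}$ having $\{A_{\mathcal{N}}^-\mid A\in\mathcal{S}\}$ as a subbase. A subbase for a topology on $Y$ is a family of open sets whose finite (non-empty) intersections form a base; in particular its union is $Y$. *)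

theory Defs
  imports "HOL-Analysis.Analysis"
begin

definition CL :: "'a topology \<Rightarrow> 'a set set" where
  "CL Y = {C. C \<noteq> {} \<and> closedin Y C}"

(* The intersections are over non-empty finite subfamilies; as topspace Y is open,
   the union of a subbase is topspace Y. *)
definition subbase_of :: "'a topology \<Rightarrow> 'a set set \<Rightarrow> bool" where
  "subbase_of Y \<S> \<longleftrightarrow>
     (\<forall>A\<in>\<S>. openin Y A) \<and>
     openin Y = arbitrary union_of (finite' intersection_of (\<lambda>A. A \<in> \<S>))"

definition hit :: "'a set set \<Rightarrow> 'a set \<Rightarrow> 'a set set" where
  "hit \<N> A = {N \<in> \<N>. N \<inter> A \<noteq> {}}"

(* The topology on \<N> with the sets hit \<N> A, A \<in> \<S>, as a subbase. Its carrier is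
   all of \<N> only if every member of \<N> meets \<Union>\<S>; see the two lemmas below. *)
definition hit_topology :: "'a set set \<Rightarrow> 'a set set \<Rightarrow> 'a set topology" where
  "hit_topology \<N> \<S> = topology_generated_by (hit \<N> ` \<S>)"

(* The map 2^h with domain \<N>, for h into the space Z; it is undefined outside \<N>, so that
   HOL equality of such maps is equality of maps on their domains. *)
definition two_pow :: "'a set set \<Rightarrow> 'b topology \<Rightarrow> ('a \<Rightarrow> 'b) \<Rightarrow> 'a set \<Rightarrow> 'b set" where
  "two_pow \<N> Z h = (\<lambda>C\<in>\<N>. Z closure_of (h ` C))"

lemma topspace_hit_topology:
  assumes "\<forall>N\<in>\<N>. N \<inter> \<Union>\<S> \<noteq> {}"
  shows "topspace (hit_topology \<N> \<S>) = \<N>"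
  using assms unfolding hit_topology_def topology_generated_by_topspace hit_def by blast

lemma subbase_of_hit_topology: "subbase_of (hit_topology \<N> \<S>) (hit \<N> ` \<S>)"
  unfolding subbase_of_def
proof
  show "\<forall>W\<in>hit \<N> ` \<S>. openin (hit_topology \<N> \<S>) W"
    by (auto simp: hit_topology_def intro: topology_generated_by_Basis)
  show "openin (hit_topology \<N> \<S>) =
      arbitrary union_of (finite' intersection_of (\<lambda>W. W \<in> hit \<N> ` \<S>))"
    unfolding generate_topology_on_eq [symmetric]
    by (rule ext) (simp only: hit_topology_def openin_topology_generated_by_iff)
qed

end

theory Submission
  imports Defs
begin

text \<open>
  A map that pulls a subbase back to open sets is continuous, and a continuous map \<open>g\<close> satisfies
  \<open>g(cl A) \<subseteq> cl(g(A))\<close>. Hence \<open>g(cl(f(C)))\<close> lies between \<open>g(f(C))\<close> and the closure of \<open>g(f(C))\<close>, so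
  it has the same closure as \<open>g(f(C))\<close>; this is functoriality. The identity law holds because a
  closed set is its own closure. Since a subbase covers the space, every non-empty subset of the
  space is hit by some subbasic set, so the carriers of the hit topologies are the full families
  of sets, and the maps \<open>2\<^sup>h\<close> have the required domains and codomains.
\<close>

text \<open>
  The space is recovered from its subbase, so its carrier is the union of the subbase, and
  continuity of maps into it can be tested on subbasic sets.
\<close>
lemma subbase_of_eq_topology_generated_by:
  assumes "subbase_of Y \<S>"
  shows "Y = topology_generated_by \<S>"
proof -
  have "openin Y = generate_topology_on \<S>"
    using assms unfolding subbase_of_def generate_topology_on_eq by blast
  then show ?thesis
    by (metis openin_inverse)
qed

lemma subbase_of_Union:
  assumes "subbase_of Y \<S>"
  shows "\<Union>\<S> = topspace Y"
  using subbase_of_eq_topology_generated_by[OF assms] topology_generated_by_topspace by metis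

lemma continuous_map_subbase:
  assumes X: "subbase_of X \<P>" and Y: "subbase_of Y \<S>"
    and h: "h \<in> topspace X \<rightarrow> topspace Y"
    and pre: "\<forall>U\<in>\<S>. {x \<in> topspace X. h x \<in> U} \<in> \<P>"
  shows "continuous_map X Y h"
proof -
  have "openin X (h -` U \<inter> topspace X)" if "U \<in> \<S>" for U
  proof -
    have "h -` U \<inter> topspace X = {x \<in> topspace X. h x \<in> U}" by blast
    moreover have "\<forall>A\<in>\<P>. openin X A" using X unfolding subbase_of_def by blast
    ultimately show ?thesis using pre that by simp
  qed
  moreover have "h ` topspace X \<subseteq> \<Union>\<S>"
    using h subbase_of_Union[OF Y] by blast
  ultimately have "continuous_map X (topology_generated_by \<S>) h"
    by (intro continuous_on_generated_topo)
  then show ?thesis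
    using subbase_of_eq_topology_generated_by[OF Y] by simp
qed

lemma topspace_hit_topology_subbase:
  assumes "subbase_of Y \<S>" and "\<forall>N\<in>\<N>. N \<noteq> {} \<and> N \<subseteq> topspace Y"
  shows "topspace (hit_topology \<N> \<S>) = \<N>"
  using assms by (intro topspace_hit_topology) (simp add: subbase_of_Union Int_absorb2)

lemma topspace_hit_topology_CL:
  assumes "subbase_of Y \<S>"
  shows "topspace (hit_topology (CL Y) \<S>) = CL Y"
  using assms by (rule topspace_hit_topology_subbase) (auto simp: CL_def dest: closedin_subset)

lemma two_pow_PiE_CL:
  assumes "h \<in> Y \<rightarrow> topspace Z" and "\<forall>N\<in>\<N>. N \<noteq> {} \<and> N \<subseteq> Y"
  shows "two_pow \<N> Z h \<in> \<N> \<rightarrow>\<^sub>E CL Z"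
proof -
  have "Z closure_of (h ` N) \<in> CL Z" if "N \<in> \<N>" for N
  proof -
    have "h ` N \<noteq> {}" "h ` N \<subseteq> topspace Z"
      using assms that by blast+
    then show ?thesis
      using closure_of_subset[of "h ` N" Z] by (auto simp: CL_def)
  qed
  then show ?thesis by (auto simp: two_pow_def)
qed

lemma two_pow_id: "two_pow (CL X) X id = restrict id (CL X)"
  by (auto simp: two_pow_def CL_def closure_of_closedin intro!: restrict_ext)

text \<open>
  Continuity sends limit points of \<open>A\<close> into the closure of \<open>g(A)\<close>, so closing the image absorbs a
  closure taken beforehand.
\<close>
lemma closure_of_image_closure_of:
  assumes g: "continuous_map Y Z g" and A: "A \<subseteq> topspace Y"
  shows "Z closure_of (g ` (Y closure_of A)) = Z closure_of (g ` A)"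
proof
  show "Z closure_of (g ` (Y closure_of A)) \<subseteq> Z closure_of (g ` A)"
    using continuous_map_image_closure_subset[OF g] by (intro closure_of_minimal) auto
  show "Z closure_of (g ` A) \<subseteq> Z closure_of (g ` (Y closure_of A))"
    using closure_of_subset[OF A] by (intro closure_of_mono image_mono)
qed

text \<open>
  The closure taken in the middle space has to be moved past the outer map \<open>g\<close>, which is what
  its continuity permits.
\<close>
lemma two_pow_comp:
  assumes g: "continuous_map Y Z g" and f: "f \<in> X \<rightarrow> topspace Y"
    and N: "\<forall>N\<in>\<N>. N \<noteq> {} \<and> N \<subseteq> X"
  shows "two_pow \<N> Z (g \<circ> f) = compose \<N> (two_pow (CL Y) Z g) (two_pow \<N> Y f)"
proof
  fix C
  show "two_pow \<N> Z (g \<circ> f) C = compose \<N> (two_pow (CL Y) Z g) (two_pow \<N> Y f) C"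
  proof (cases "C \<in> \<N>")
    case True
    then have "f ` C \<subseteq> topspace Y"
      using f N by blast
    moreover have "Y closure_of (f ` C) \<in> CL Y"
      using PiE_mem[OF two_pow_PiE_CL[OF f N] True] True by (simp add: two_pow_def)
    ultimately show ?thesis
      using True closure_of_image_closure_of[OF g] by (simp add: two_pow_def compose_def image_comp)
  next
    case False
    then show ?thesis by (simp add: two_pow_def compose_def)
  qed
qed

theorem proposition3p2:
  "(\<forall>(X :: 'a topology) \<P>.
      subbase_of X \<P> \<longrightarrow>
      (let \<M> = CL X; \<O> = hit_topology \<M> \<P> in
         two_pow \<M> X id \<in> topspace \<O> \<rightarrow>\<^sub>E topspace \<O> \<and>
         two_pow \<M> X id = restrict id (topspace \<O>)))
   \<and>
   (\<forall>(X :: 'b topology) (X' :: 'c topology) (X'' :: 'd topology) \<P> \<P>' \<P>'' f g \<M>.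
      subbase_of X \<P> \<and> subbase_of X' \<P>' \<and> subbase_of X'' \<P>'' \<and>
      f \<in> topspace X \<rightarrow> topspace X' \<and>
      g \<in> topspace X' \<rightarrow> topspace X'' \<and>
      (\<forall>U'\<in>\<P>'. {x \<in> topspace X. f x \<in> U'} \<in> \<P>) \<and>
      (\<forall>U''\<in>\<P>''. {x \<in> topspace X'. g x \<in> U''} \<in> \<P>') \<and>
      (\<forall>M\<in>\<M>. M \<noteq> {} \<and> M \<subseteq> topspace X) \<longrightarrow>
      (let \<M>' = CL X'; \<M>'' = CL X'';
           \<O> = hit_topology \<M> \<P>; \<O>' = hit_topology \<M>' \<P>'; \<O>'' = hit_topology \<M>'' \<P>'' in
         two_pow \<M> X' f \<in> topspace \<O> \<rightarrow>\<^sub>E topspace \<O>' \<and>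
         two_pow \<M>' X'' g \<in> topspace \<O>' \<rightarrow>\<^sub>E topspace \<O>'' \<and>
         two_pow \<M> X'' (g \<circ> f) \<in> topspace \<O> \<rightarrow>\<^sub>E topspace \<O>'' \<and>
         two_pow \<M> X'' (g \<circ> f) = compose (topspace \<O>) (two_pow \<M>' X'' g) (two_pow \<M> X' f)))"
proof (intro conjI allI impI, goal_cases)
  case (1 X \<P>)
  have "two_pow (CL X) X id \<in> CL X \<rightarrow>\<^sub>E CL X"
    by (simp add: two_pow_id)
  then show ?case
    by (simp add: Let_def topspace_hit_topology_CL[OF 1] two_pow_id)
next
  case (2 X X' X'' \<P> \<P>' \<P>'' f g \<M>)
  then have X: "subbase_of X \<P>" and X': "subbase_of X' \<P>'" and X'': "subbase_of X'' \<P>''"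
    and f: "f \<in> topspace X \<rightarrow> topspace X'" and g: "g \<in> topspace X' \<rightarrow> topspace X''"
    and pre: "\<forall>U''\<in>\<P>''. {x \<in> topspace X'. g x \<in> U''} \<in> \<P>'"
    and M: "\<forall>M\<in>\<M>. M \<noteq> {} \<and> M \<subseteq> topspace X"
    by blast+
  have gf: "g \<circ> f \<in> topspace X \<rightarrow> topspace X''"
    using f g by auto
  have CL: "\<forall>M\<in>CL X'. M \<noteq> {} \<and> M \<subseteq> topspace X'"
    by (auto simp: CL_def dest: closedin_subset)
  show ?case
    unfolding Let_def topspace_hit_topology_subbase[OF X M]
      topspace_hit_topology_CL[OF X'] topspace_hit_topology_CL[OF X'']
    using two_pow_PiE_CL[OF f M] two_pow_PiE_CL[OF g CL] two_pow_PiE_CL[OF gf M]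
      two_pow_comp[OF continuous_map_subbase[OF X' X'' g pre] f M]
    by blast
qed

end
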